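(* Let $\mathcal{H}$ be a Hilbert space and let $T\in\mathcal{L}(\mathcal{H})$ belong to the class $\mathcal{D}$. Then: (i) $P_0:=I-TT^{-}$ is the orthogonal projection of $\mathcal{H}$ onto $W:=\mathcal{H}\ominus T\mathcal{H}$; (ii) as $n\to\infty$, $T^n(T^{-})^n$ converges strongly to the orthogonal projection $P$ of $\mathcal{H}$ onto $\bigcap_{n=1}^{\infty}T^n\mathcal{H}$; (iii) $\sum_{j=0}^{\infty}T^jP_0(T^{-})^j$ converges strongly to $Q:=I-P$; (iv) $Q\mathcal{H}=\{h\in\mathcal{H}:\ \lim_{n\to\infty}\|({T^*}^nT^n)^{-1/2}{T^*}^nh\|=0\}$; (v) $P\mathcal{H}$ and $Q\mathcal{H}$ reduce $T$; (vi) $T|_{P\mathcal{H}}$ is surjective, as an operator from $P\mathcal{H}$ to $P\mathcal{H}$; (vii) $I=P+\sum_{j=0}^{\infty}T^jP_0(T^{-})^j$, the series converging strongly.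
   Context: $\mathcal{L}(\mathcal{H})$ is the algebra of bounded linear operators on the Hilbert space $\mathcal{H}$, and $T^*$ is the adjoint of $T$. If $T\in\mathcal{L}(\mathcal{H})$ is left invertible (equivalently, bounded below; equivalently, $T^*T$ is invertible), then $T\mathcal{H}$ is closed, every power $T^n$ is left invertible, and one sets $T^{-}:=(T^*T)^{-1}T^*$, a particular left inverse of $T$. The class $\mathcal{D}$ is the set of all left invertible operators $T\in\mathcal{L}(\mathcal{H})$ such that $(T^n)^{-}=(T^{-})^n$ for all $n\ge 2$, where $(T^n)^{-}=({T^*}^nT^n)^{-1}{T^*}^n$. $\mathcal{H}\ominus T\mathcal{H}$ denotes the orthogonal complement of $T\mathcal{H}$ in $\mathcal{H}$. A closed subspace reduces $T$ if it is invariant under both $T$ and $T^*$. *)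

theory Defs
  imports "HOL-Analysis.Analysis"
begin

text \<open>
  Complex Hilbert spaces: complete real normed spaces whose real scalar multiplication extends to
  the complex numbers and whose norm is induced by a complex inner product. The inner product is
  linear in its first argument. The last axiom contains positive definiteness.
\<close>

class complex_hilbert_space = banach +
  fixes scaleC :: "complex \<Rightarrow> 'a \<Rightarrow> 'a" (infixr "*\<^sub>C" 75)
    and cinner :: "'a \<Rightarrow> 'a \<Rightarrow> complex"
  assumes scaleC_add_right: "c *\<^sub>C (x + y) = c *\<^sub>C x + c *\<^sub>C y"
    and scaleC_add_left: "(c + d) *\<^sub>C x = c *\<^sub>C x + d *\<^sub>C x"
    and scaleC_scaleC: "c *\<^sub>C (d *\<^sub>C x) = (c * d) *\<^sub>C x"
    and scaleC_of_real: "complex_of_real r *\<^sub>C x = r *\<^sub>R x"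
    and cinner_commute: "cinner y x = cnj (cinner x y)"
    and cinner_add_left: "cinner (x + y) z = cinner x z + cinner y z"
    and cinner_scaleC_left: "cinner (c *\<^sub>C x) y = c * cinner x y"
    and cinner_self: "cinner x x = complex_of_real ((norm x)\<^sup>2)"

instantiation complex :: complex_hilbert_space
begin

definition scaleC_complex :: "complex \<Rightarrow> complex \<Rightarrow> complex"
  where "scaleC_complex c x = c * x"

definition cinner_complex :: "complex \<Rightarrow> complex \<Rightarrow> complex"
  where "cinner_complex x y = x * cnj y"

instance
  by standard
    (auto simp: scaleC_complex_def cinner_complex_def algebra_simps scaleR_conv_of_real
      complex_mult_cnj cmod_def complex_eq_iff power2_eq_square)

end

definition csubspace :: "'a::complex_hilbert_space set \<Rightarrow> bool"
  where "csubspace M \<longleftrightarrow>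
    0 \<in> M \<and> (\<forall>x\<in>M. \<forall>y\<in>M. x + y \<in> M) \<and> (\<forall>c. \<forall>x\<in>M. c *\<^sub>C x \<in> M)"

definition orth_compl :: "'a::complex_hilbert_space set \<Rightarrow> 'a set"
  where "orth_compl M = {h. \<forall>m\<in>M. cinner h m = 0}"

definition is_orth_proj :: "('a::complex_hilbert_space \<Rightarrow> 'a) \<Rightarrow> 'a set \<Rightarrow> bool"
  where "is_orth_proj P M \<longleftrightarrow>
    csubspace M \<and> closed M \<and> (\<forall>h. P h \<in> M \<and> h - P h \<in> orth_compl M)"

lemma is_orth_proj_unique:
  assumes "is_orth_proj P M" "is_orth_proj P' M"
  shows "P = P'"
proof
  fix h
  let ?d = "P h - P' h"
  have sub: "csubspace M"
    using assms by (auto simp: is_orth_proj_def)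
  have in_M: "P h \<in> M" "P' h \<in> M"
    using assms by (auto simp: is_orth_proj_def)
  have "- P' h = complex_of_real (- 1) *\<^sub>C P' h"
    by (simp only: scaleC_of_real scaleR_minus1_left)
  then have "- P' h \<in> M"
    using sub in_M by (simp add: csubspace_def)
  then have d: "?d \<in> M"
    using sub in_M unfolding csubspace_def diff_conv_add_uminus by blast
  have "cinner (h - P h) ?d = 0" "cinner (h - P' h) ?d = 0"
    using assms d by (auto simp: is_orth_proj_def orth_compl_def)
  moreover have "cinner (h - P' h) ?d = cinner (h - P h) ?d + cinner ?d ?d"
    by (simp flip: cinner_add_left)
  ultimately have "cinner ?d ?d = 0"
    by simp
  then show "P h = P' h"
    by (simp add: cinner_self)
qed

text \<open>Elements of the operator algebra are represented by functions satisfying this predicate.\<close>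

definition bounded_clinear :: "('a::complex_hilbert_space \<Rightarrow> 'a) \<Rightarrow> bool"
  where "bounded_clinear T \<longleftrightarrow> bounded_linear T \<and> (\<forall>c x. T (c *\<^sub>C x) = c *\<^sub>C T x)"

definition cadjoint :: "('a::complex_hilbert_space \<Rightarrow> 'a) \<Rightarrow> 'a \<Rightarrow> 'a"
  where "cadjoint T = (THE S. \<forall>x y. cinner (T x) y = cinner x (S y))"

definition left_invertible :: "('a::complex_hilbert_space \<Rightarrow> 'a) \<Rightarrow> bool"
  where "left_invertible T \<longleftrightarrow> (\<exists>S. bounded_clinear S \<and> S \<circ> T = id)"

definition can_left_inv :: "('a::complex_hilbert_space \<Rightarrow> 'a) \<Rightarrow> 'a \<Rightarrow> 'a"
  where "can_left_inv T = inv (cadjoint T \<circ> T) \<circ> cadjoint T"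

definition class_D :: "('a::complex_hilbert_space \<Rightarrow> 'a) set"
  where "class_D = {T. bounded_clinear T \<and> left_invertible T \<and>
    (\<forall>n\<ge>2. can_left_inv (T ^^ n) = can_left_inv T ^^ n)}"

text \<open>On a complex space, positivity of the quadratic form already implies self-adjointness.\<close>

definition positive_op :: "('a::complex_hilbert_space \<Rightarrow> 'a) \<Rightarrow> bool"
  where "positive_op A \<longleftrightarrow> bounded_clinear A \<and> (\<forall>h. cinner (A h) h \<in> \<real>\<^sub>\<ge>\<^sub>0)"

definition sqrt_op :: "('a::complex_hilbert_space \<Rightarrow> 'a) \<Rightarrow> 'a \<Rightarrow> 'a"
  where "sqrt_op A = (THE S. positive_op S \<and> S \<circ> S = A)"

definition inv_sqrt_op :: "('a::complex_hilbert_space \<Rightarrow> 'a) \<Rightarrow> 'a \<Rightarrow> 'a"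
  where "inv_sqrt_op A = inv (sqrt_op A)"

definition reduces :: "'a::complex_hilbert_space set \<Rightarrow> ('a \<Rightarrow> 'a) \<Rightarrow> bool"
  where "reduces M T \<longleftrightarrow>
    csubspace M \<and> closed M \<and> T ` M \<subseteq> M \<and> cadjoint T ` M \<subseteq> M"

end

theory Submission imports Defs begin

text \<open>For \<open>T\<close> in the class, \<open>E n = T^n (T\<^sup>-)^n\<close> is the orthogonal projection onto the range of \<open>T^n\<close>.
  These projections decrease, so they converge strongly to the projection \<open>P\<close> onto the intersection
  of the ranges, and the series in question telescopes to \<open>I - P\<close>. Passing to the limit in
  \<open>T (E n) T\<^sup>- = E (n + 1)\<close> gives \<open>T P T\<^sup>- = P\<close>, hence \<open>T P = P T\<close>, from which the reduction and
  surjectivity claims follow. Finally \<open>\<parallel>(T*^n T^n)^(-1/2) T*^n h\<parallel> = \<parallel>E n h\<parallel>\<close>, whose limit vanishes exactly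
  on the kernel of \<open>P\<close>.\<close>

subsection \<open>The inner product\<close>

lemma cinner_add_right: "cinner x (y + z) = cinner x y + cinner x z"
  by (metis cinner_add_left cinner_commute complex_cnj_add)

lemma cinner_scaleC_right: "cinner x (c *\<^sub>C y) = cnj c * cinner x y"
  by (metis cinner_scaleC_left cinner_commute complex_cnj_mult)

lemma cinner_scaleR_left: "cinner (r *\<^sub>R x) y = r *\<^sub>R cinner x y"
  by (metis cinner_scaleC_left scaleC_of_real scaleR_conv_of_real)

lemma cinner_scaleR_right: "cinner x (r *\<^sub>R y) = r *\<^sub>R cinner x y"
  by (metis cinner_scaleC_right scaleC_of_real scaleR_conv_of_real complex_cnj_complex_of_real)

lemma norm_scaleC: "norm (c *\<^sub>C x) = cmod c * norm x"
proof -
  have "complex_of_real ((norm (c *\<^sub>C x))\<^sup>2) = (c * cnj c) * complex_of_real ((norm x)\<^sup>2)"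
    unfolding cinner_self[symmetric] cinner_scaleC_left cinner_scaleC_right by (simp add: mult_ac)
  also have "\<dots> = complex_of_real ((cmod c * norm x)\<^sup>2)"
    by (simp only: complex_norm_square[symmetric] of_real_mult[symmetric] power_mult_distrib)
  finally have "(norm (c *\<^sub>C x))\<^sup>2 = (cmod c * norm x)\<^sup>2"
    by (simp only: of_real_eq_iff)
  then show ?thesis
    by (simp add: power2_eq_iff_nonneg)
qed

lemma norm_add_square:
  "(norm (x + y))\<^sup>2 = (norm x)\<^sup>2 + (norm y)\<^sup>2 + 2 * Re (cinner x y)"
proof -
  have "complex_of_real ((norm (x + y))\<^sup>2)
      = complex_of_real ((norm x)\<^sup>2) + complex_of_real ((norm y)\<^sup>2) + (cinner x y + cnj (cinner x y))"
    unfolding cinner_self[symmetric] cinner_commute[of y x, symmetric]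
    by (simp add: cinner_add_left cinner_add_right)
  from arg_cong[OF this, of Re] show ?thesis
    by simp
qed

text \<open>Real Cauchy-Schwarz read off from the triangle inequality: squaring
  \<open>norm (u + y) \<le> norm u + norm y\<close> and expanding leaves exactly the bound on the
  cross term. Using it for \<open>x\<close> and \<open>- x\<close> gives the absolute value.\<close>

lemma abs_Re_cinner_le: "\<bar>Re (cinner x y)\<bar> \<le> norm x * norm y"
proof -
  have *: "Re (cinner u y) \<le> norm u * norm y" for u
  proof -
    have "(norm (u + y))\<^sup>2 \<le> (norm u + norm y)\<^sup>2"
      by (simp add: norm_triangle_ineq power_mono)
    then show ?thesis
      unfolding norm_add_square by (simp add: power2_sum)
  qed
  have "Re (cinner (- x) y) = - Re (cinner x y)"
    using cinner_scaleR_left[of "- 1" x y] by simp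
  with *[of x] *[of "- x"] show ?thesis
    by simp
qed

text \<open>The constant 2 is crude, from bounding real and imaginary part separately. It serves
  only to make \<open>cinner\<close> a bounded bilinear map, hence continuous.\<close>

lemma norm_cinner_le: "norm (cinner x y) \<le> norm x * norm y * 2"
proof -
  have "\<bar>Im (cinner x y)\<bar> = \<bar>Re (cinner (\<i> *\<^sub>C x) y)\<bar>"
    by (simp add: cinner_scaleC_left)
  also have "\<dots> \<le> norm x * norm y"
    using abs_Re_cinner_le[of "\<i> *\<^sub>C x" y] by (simp add: norm_scaleC)
  finally show ?thesis
    using abs_Re_cinner_le[of x y] cmod_le[of "cinner x y"] by linarith
qed

lemma bounded_bilinear_cinner: "bounded_bilinear cinner"
  by standard
    (auto simp: cinner_add_left cinner_add_right cinner_scaleR_left cinner_scaleR_right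
      intro!: exI[of _ 2] norm_cinner_le)

lemmas tendsto_cinner [tendsto_intros] = bounded_bilinear.tendsto[OF bounded_bilinear_cinner]
lemmas continuous_on_cinner [continuous_intros] =
  bounded_bilinear.continuous_on[OF bounded_bilinear_cinner]
lemmas cinner_diff_left = bounded_bilinear.diff_left[OF bounded_bilinear_cinner]
lemmas cinner_diff_right = bounded_bilinear.diff_right[OF bounded_bilinear_cinner]
lemmas cinner_zero_left [simp] = bounded_bilinear.zero_left[OF bounded_bilinear_cinner]
lemmas cinner_zero_right [simp] = bounded_bilinear.zero_right[OF bounded_bilinear_cinner]

lemma norm_diff_square:
  "(norm (x - y))\<^sup>2 = (norm x)\<^sup>2 + (norm y)\<^sup>2 - 2 * Re (cinner x y)"
  using norm_add_square[of x "- 1 *\<^sub>R y"] cinner_scaleR_right[of x "- 1" y] by simp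

lemma cinner_self_eq_0_iff [simp]: "cinner x x = 0 \<longleftrightarrow> x = 0"
  by (simp add: cinner_self)

lemma cinner_eq_left_iff: "(\<forall>z. cinner x z = cinner y z) \<longleftrightarrow> x = y"
  by (metis cinner_diff_left cinner_self_eq_0_iff diff_self right_minus_eq)

lemma cinner_eq_right_iff: "(\<forall>z. cinner z x = cinner z y) \<longleftrightarrow> x = y"
  by (metis cinner_eq_left_iff cinner_commute)

lemma csubspace_diff: "csubspace M \<Longrightarrow> x \<in> M \<Longrightarrow> y \<in> M \<Longrightarrow> x - y \<in> M"
  unfolding csubspace_def
  by (metis diff_conv_add_uminus of_real_1 of_real_minus scaleC_of_real scaleR_minus1_left)


subsection \<open>Riesz representation and adjoints\<close>

text \<open>Variational proof. If \<open>v\<close> represents \<open>f\<close>, then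
  \<open>(norm x)\<^sup>2 - 2 * Re (f x)\<close> equals
  \<open>(norm (x - v))\<^sup>2 - (norm v)\<^sup>2\<close>, so \<open>v\<close> is sought as the
  minimiser of this functional \<open>F\<close>.\<close>

lemma riesz_representation:
  fixes f :: "'a::complex_hilbert_space \<Rightarrow> complex"
  assumes f: "bounded_linear f" and fC: "\<And>c x. f (c *\<^sub>C x) = c * f x"
  shows "\<exists>v. \<forall>x. f x = cinner x v"
proof -
  interpret f: bounded_linear f by fact
  define F where "F x = (norm x)\<^sup>2 - 2 * Re (f x)" for x
  obtain K where K: "\<And>x. norm (f x) \<le> norm x * K"
    using f.bounded by blast
  have below: "F x \<ge> - K\<^sup>2" for x
  proof -
    have "Re (f x) \<le> norm x * K"
      using K[of x] complex_Re_le_cmod[of "f x"] by linarith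
    moreover have "0 \<le> (norm x - K)\<^sup>2" by simp
    ultimately show ?thesis
      unfolding F_def power2_diff by linarith
  qed
  define m where "m = Inf (range F)"
  have m: "m \<le> F x" for x
    unfolding m_def using below by (intro cInf_lower) (auto intro!: bdd_belowI)
  have "\<exists>x. F x < m + 1 / real (Suc n)" for n
    using cInf_lessD[of "range F" "m + 1 / real (Suc n)"] by (auto simp: m_def)
  then obtain X where X: "\<And>n. F (X n) < m + 1 / real (Suc n)"
    by metis
  have half: "(norm ((1/2) *\<^sub>R z))\<^sup>2 = (norm z)\<^sup>2 / 4" for z :: 'a
    by (simp add: power_divide)
  \<comment> \<open>Parallelogram law; the linear terms of \<open>F\<close> cancel. Since
    \<open>F\<close> at the midpoint is at least \<open>m\<close>, every minimising sequence is
    Cauchy.\<close>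
  have par: "(norm (x - y))\<^sup>2 = 2 * F x + 2 * F y - 4 * F ((1/2) *\<^sub>R (x + y))" for x y
    unfolding F_def half norm_diff_square norm_add_square f.scaleR f.add by (simp add: field_simps)
  have near: "(norm (X i - X j))\<^sup>2 \<le> 2 / real (Suc i) + 2 / real (Suc j)" for i j
    using par[of "X i" "X j"] X[of i] X[of j] m[of "(1/2) *\<^sub>R (X i + X j)"] by simp
  have "Cauchy X"
  proof (rule metric_CauchyI)
    fix e :: real assume e: "e > 0"
    obtain N where N: "inverse (real (Suc N)) < e\<^sup>2 / 4"
      using reals_Archimedean[of "e\<^sup>2 / 4"] e by auto
    have "dist (X i) (X j) < e" if "i \<ge> N" "j \<ge> N" for i j
    proof -
      have "1 / real (Suc k) \<le> inverse (real (Suc N))" if "k \<ge> N" for k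
        using that by (simp add: field_simps)
      then have "1 / real (Suc i) < e\<^sup>2 / 4" "1 / real (Suc j) < e\<^sup>2 / 4"
        using that N by (meson le_less_trans)+
      moreover have "(norm (X i - X j))\<^sup>2 \<le> 2 * (1 / real (Suc i)) + 2 * (1 / real (Suc j))"
        using near[of i j] by simp
      ultimately have "(norm (X i - X j))\<^sup>2 < e\<^sup>2"
        by linarith
      then show ?thesis
        using e by (simp add: dist_norm power_less_imp_less_base)
    qed
    then show "\<exists>M. \<forall>i\<ge>M. \<forall>j\<ge>M. dist (X i) (X j) < e"
      by blast
  qed
  then obtain v where v: "X \<longlonglongrightarrow> v"
    using Cauchy_convergent convergent_def by blast
  have "(\<lambda>n. F (X n)) \<longlonglongrightarrow> F v"
    unfolding F_def by (intro tendsto_intros f.tendsto v)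
  moreover have "(\<lambda>n. m + 1 / real (Suc n)) \<longlonglongrightarrow> m"
    using LIMSEQ_inverse_real_of_nat_add[of m] by (simp add: inverse_eq_divide)
  ultimately have "F v \<le> m"
    by (rule LIMSEQ_le) (use X in \<open>blast intro: less_imp_le\<close>)
  then have min: "F v \<le> F x" for x
    using m[of x] by simp
  have Re_eq: "Re (f y) = Re (cinner y v)" for y
  proof -
    define d where "d = Re (cinner y v) - Re (f y)"
    have "0 \<le> t\<^sup>2 * (norm y)\<^sup>2 + 2 * t * d" for t
      using min[of "t *\<^sub>R y + v"]
      unfolding F_def norm_add_square d_def
      by (simp add: f.add f.scaleR cinner_scaleR_left power_mult_distrib algebra_simps)
    \<comment> \<open>The quadratic in \<open>t\<close> has its minimum at
      \<open>- d / (norm y)\<^sup>2\<close>. Adding 1 to the denominator also covers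
      \<open>y = 0\<close> and still makes the value negative unless \<open>d = 0\<close>.\<close>
    from this[of "- d / ((norm y)\<^sup>2 + 1)"]
    have "0 \<le> (d\<^sup>2 * (norm y)\<^sup>2) / ((norm y)\<^sup>2 + 1)\<^sup>2 - 2 * d\<^sup>2 / ((norm y)\<^sup>2 + 1)"
      by (simp add: power_divide power2_eq_square)
    also have "\<dots> = - d\<^sup>2 * ((norm y)\<^sup>2 + 2) / ((norm y)\<^sup>2 + 1)\<^sup>2"
    proof -
      have "(norm y)\<^sup>2 + 1 \<noteq> 0"
        by (metis add_nonneg_eq_0_iff zero_le_one zero_le_power2 zero_neq_one)
      then have "2 * d\<^sup>2 / ((norm y)\<^sup>2 + 1) = 2 * d\<^sup>2 * ((norm y)\<^sup>2 + 1) / ((norm y)\<^sup>2 + 1)\<^sup>2"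
        by (simp add: power2_eq_square[of "_ + _"])
      then show ?thesis
        by (simp add: diff_divide_distrib[symmetric] algebra_simps)
    qed
    finally have "d\<^sup>2 * ((norm y)\<^sup>2 + 2) / ((norm y)\<^sup>2 + 1)\<^sup>2 \<le> 0"
      by simp
    moreover have "(norm y)\<^sup>2 + 1 > 0" "(norm y)\<^sup>2 + 2 > 0"
      by (simp_all add: add_nonneg_pos)
    ultimately have "d\<^sup>2 \<le> 0"
      by (simp add: divide_le_0_iff mult_le_0_iff)
    then have "d = 0" by simp
    then show ?thesis by (simp add: d_def)
  qed
  have "f x = cinner x v" for x
  proof (rule complex_eqI)
    show "Re (f x) = Re (cinner x v)" by (rule Re_eq)
    \<comment> \<open>Complex linearity turns imaginary parts into real ones:
      \<open>Im z = - Re (\<i> * z)\<close>.\<close>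
    show "Im (f x) = Im (cinner x v)"
      using Re_eq[of "\<i> *\<^sub>C x"] by (simp add: fC cinner_scaleC_left)
  qed
  then show ?thesis by blast
qed

lemma cadjoint_eqI:
  assumes "\<And>x y. cinner (T x) y = cinner x (S y)"
  shows "cadjoint T = S"
  unfolding cadjoint_def
proof (rule the_equality)
  show "\<forall>x y. cinner (T x) y = cinner x (S y)" using assms by blast
  show "R = S" if "\<forall>x y. cinner (T x) y = cinner x (R y)" for R
    using that assms by (metis cinner_eq_right_iff ext)
qed

lemma bounded_clinearD:
  assumes "bounded_clinear T"
  shows "bounded_linear T" "T (c *\<^sub>C x) = c *\<^sub>C T x"
  using assms by (auto simp: bounded_clinear_def)

lemma cinner_cadjoint:
  assumes T: "bounded_clinear T"
  shows "cinner (T x) y = cinner x (cadjoint T y)"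
proof -
  have "\<exists>v. \<forall>x. cinner (T x) y = cinner x v" for y
  proof (rule riesz_representation)
    show "bounded_linear (\<lambda>x. cinner (T x) y)"
      using bounded_linear_compose[OF
          bounded_bilinear.bounded_linear_left[OF bounded_bilinear_cinner] bounded_clinearD(1)[OF T]]
      by (simp add: o_def)
  qed (simp add: bounded_clinearD[OF T] cinner_scaleC_left)
  then obtain S where "\<And>x y. cinner (T x) y = cinner x (S y)"
    by metis
  then show ?thesis
    by (metis cadjoint_eqI)
qed

lemma cinner_cadjoint_left:
  assumes "bounded_clinear T"
  shows "cinner (cadjoint T x) y = cinner x (T y)"
  by (metis assms cinner_cadjoint cinner_commute)

lemma bounded_clinear_cadjoint:
  assumes T: "bounded_clinear T"
  shows "bounded_clinear (cadjoint T)"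
proof -
  let ?S = "cadjoint T"
  note adj = cinner_cadjoint_left[OF T]
  obtain K where K: "\<And>x. norm (T x) \<le> norm x * K"
    using bounded_linear.bounded[OF bounded_clinearD(1)[OF T]] by blast
  have scale: "?S (c *\<^sub>C x) = c *\<^sub>C ?S x" for c x
    by (subst cinner_eq_left_iff[symmetric]) (simp add: adj cinner_scaleC_left)
  have "bounded_linear ?S"
  proof (rule bounded_linear_intro[where K = K])
    show "?S (x + y) = ?S x + ?S y" for x y
      by (subst cinner_eq_left_iff[symmetric]) (simp add: adj cinner_add_left)
    show "?S (r *\<^sub>R x) = r *\<^sub>R ?S x" for r x
      using scale[of "complex_of_real r" x] by (simp add: scaleC_of_real)
    show "norm (?S x) \<le> norm x * K" for x
    \<comment> \<open>The estimate is
      \<open>(norm (?S x))\<^sup>2 \<le> norm x * norm (T (?S x))\<close>; the case split permits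
      cancelling one factor \<open>norm (?S x)\<close>.\<close>
    proof (cases "?S x = 0")
      case True
      then show ?thesis using K[of x] norm_ge_zero[of "T x"] by (metis norm_zero order_trans)
    next
      case False
      have "(norm (?S x))\<^sup>2 = Re (cinner x (T (?S x)))"
        by (simp add: adj[symmetric] cinner_self)
      also have "\<dots> \<le> norm x * (norm (?S x) * K)"
        using abs_Re_cinner_le[of x "T (?S x)"] mult_left_mono[OF K[of "?S x"] norm_ge_zero[of x]]
        by linarith
      finally have "norm (?S x) * norm (?S x) \<le> norm (?S x) * (norm x * K)"
        by (simp add: power2_eq_square algebra_simps)
      with False show ?thesis by simp
    qed
  qed
  with scale show ?thesis by (simp add: bounded_clinear_def)
qed

lemma bounded_clinear_id: "bounded_clinear id"
  by (simp add: bounded_clinear_def bounded_linear_ident id_def)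

lemma bounded_clinear_comp:
  assumes "bounded_clinear S" "bounded_clinear T"
  shows "bounded_clinear (S \<circ> T)"
  using assms bounded_linear_compose[of S T] by (simp add: bounded_clinear_def o_def)

lemma bounded_clinear_funpow:
  assumes "bounded_clinear T"
  shows "bounded_clinear (T ^^ n)"
proof (induction n)
  case 0
  show ?case using bounded_clinear_id by (simp add: id_def)
next
  case (Suc n)
  show ?case unfolding funpow.simps by (rule bounded_clinear_comp[OF assms Suc])
qed

lemma cadjoint_funpow:
  assumes T: "bounded_clinear T"
  shows "cadjoint (T ^^ n) = cadjoint T ^^ n"
proof (rule cadjoint_eqI)
  show "cinner ((T ^^ n) x) y = cinner x ((cadjoint T ^^ n) y)" for x y
    by (induction n arbitrary: x y) (simp_all add: cinner_cadjoint[OF T] funpow_swap1)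
qed

lemma funpow_inverse_cancel:
  fixes S T :: "'a \<Rightarrow> 'a"
  shows "S \<circ> T = id \<Longrightarrow> (S ^^ n) ((T ^^ n) x) = x"
proof (induction n arbitrary: x)
  case (Suc n)
  then show ?case
    using pointfree_idE[OF Suc.prems] by (simp add: funpow_swap1[of S])
qed simp


subsection \<open>Coercive operators and their square roots\<close>

text \<open>Expanding \<open>(norm (x - t *\<^sub>R A x))\<^sup>2\<close> and inserting both bounds
  on \<open>A\<close> gives the factor \<open>1 - 2 * t * c + t\<^sup>2 * K\<^sup>2\<close>, which
  is smallest at \<open>t = c / K\<^sup>2\<close> with value
  \<open>1 - c\<^sup>2 / K\<^sup>2\<close>.\<close>

lemma coercive_contraction:
  fixes A :: "'a::complex_hilbert_space \<Rightarrow> 'a"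
  assumes A: "bounded_linear A" and c: "c > 0"
    and coercive: "\<And>x. c * (norm x)\<^sup>2 \<le> Re (cinner (A x) x)"
  obtains t b where "t > 0" "0 \<le> b" "b < 1" "\<And>x. norm (x - t *\<^sub>R A x) \<le> b * norm x"
proof -
  obtain K0 where K0: "\<And>x. norm (A x) \<le> norm x * K0"
    using bounded_linear.bounded[OF A] by blast
  \<comment> \<open>Taking the maximum with \<open>c\<close> ensures \<open>0 < c \<le> K\<close>,
    so \<open>1 - c\<^sup>2 / K\<^sup>2\<close> lies in [0, 1).\<close>
  define K where "K = max K0 c"
  have K: "norm (A x) \<le> norm x * K" for x
    using K0[of x] mult_left_mono[of K0 K "norm x"] by (simp add: K_def)
  have Kc: "c \<le> K" "K > 0" using c by (auto simp: K_def)
  define t where "t = c / K\<^sup>2"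
  define b where "b = sqrt (1 - c\<^sup>2 / K\<^sup>2)"
  have "c\<^sup>2 / K\<^sup>2 \<le> 1" "c\<^sup>2 / K\<^sup>2 > 0"
    using Kc c by (simp_all add: power_mono)
  then have b: "0 \<le> b" "b < 1" "b\<^sup>2 = 1 - c\<^sup>2 / K\<^sup>2"
    by (auto simp: b_def)
  have t: "t > 0" using Kc c by (simp add: t_def)
  have tK: "1 - 2 * t * c + t\<^sup>2 * K\<^sup>2 = b\<^sup>2"
    unfolding b t_def using Kc by (simp add: field_simps power2_eq_square)
  have "norm (x - t *\<^sub>R A x) \<le> b * norm x" for x
  proof (rule power2_le_imp_le)
    have "(norm (x - t *\<^sub>R A x))\<^sup>2 = t\<^sup>2 * (norm (A x))\<^sup>2 + (norm x)\<^sup>2 - 2 * t * Re (cinner (A x) x)"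
      by (simp add: norm_minus_commute[of x] norm_diff_square cinner_scaleR_left power_mult_distrib)
    also have "\<dots> \<le> t\<^sup>2 * (norm x * K)\<^sup>2 + (norm x)\<^sup>2 - 2 * t * (c * (norm x)\<^sup>2)"
      using K[of x] coercive[of x] t
      by (intro diff_mono add_mono mult_left_mono power_mono) auto
    also have "\<dots> = (1 - 2 * t * c + t\<^sup>2 * K\<^sup>2) * (norm x)\<^sup>2"
      by (simp add: algebra_simps power_mult_distrib)
    finally show "(norm (x - t *\<^sub>R A x))\<^sup>2 \<le> (b * norm x)\<^sup>2"
      by (simp add: tK power_mult_distrib)
  qed (use b in simp)
  with t b that show thesis by blast
qed

text \<open>Lax-Milgram argument: coercivity makes the kernel trivial, and a solution of
  \<open>A x = y\<close> is a fixed point of the contraction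
  \<open>x \<mapsto> x - t *\<^sub>R (A x - y)\<close>.\<close>

lemma coercive_bij:
  fixes A :: "'a::complex_hilbert_space \<Rightarrow> 'a"
  assumes A: "bounded_linear A" and c: "c > 0"
    and coercive: "\<And>x. c * (norm x)\<^sup>2 \<le> Re (cinner (A x) x)"
  shows "bij A"
proof -
  interpret A: bounded_linear A by fact
  obtain t b where t: "t > 0" and b: "0 \<le> b" "b < 1"
    and contr: "\<And>x. norm (x - t *\<^sub>R A x) \<le> b * norm x"
    using coercive_contraction[OF assms] by blast
  have "inj A"
  proof (rule injI)
    fix x y assume "A x = A y"
    then have "c * (norm (x - y))\<^sup>2 \<le> 0"
      using coercive[of "x - y"] by (simp add: A.diff)
    with c show "x = y"
      by (simp add: mult_le_0_iff)
  qed
  moreover have "\<exists>x. A x = y" for y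
  proof -
    have "\<exists>!x. x - t *\<^sub>R (A x - y) = x"
    proof (rule banach_fix_type[OF b], intro allI)
      show "dist (x - t *\<^sub>R (A x - y)) (z - t *\<^sub>R (A z - y)) \<le> b * dist x z" for x z
        using contr[of "x - z"] by (simp add: dist_norm A.diff algebra_simps)
    qed
    then show ?thesis using t by auto
  qed
  ultimately show ?thesis
    by (metis bij_def surj_def)
qed

text \<open>With \<open>B = I - t A\<close> a strict contraction, \<open>A\<close> is \<open>1/t\<close> times the square of \<open>I - Y\<close> exactly
  if \<open>Y = (B + Y\<^sup>2) / 2\<close>; the right-hand side is a contraction of a small ball of operators, and it
  preserves symmetry and the property of commuting with everything that commutes with \<open>B\<close>.\<close>

lemma coercive_sqrt_exists:
  fixes A :: "'a::complex_hilbert_space \<Rightarrow> 'a"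
  assumes A: "bounded_clinear A" and c: "c > 0"
    and coercive: "\<And>x. c * (norm x)\<^sup>2 \<le> Re (cinner (A x) x)"
    and sym: "\<And>x y. cinner (A x) y = cinner x (A y)"
  obtains S s where "positive_op S" "S \<circ> S = A" "s > 0"
    "\<And>x y. cinner (S x) y = cinner x (S y)"
    "\<And>x. s * (norm x)\<^sup>2 \<le> Re (cinner (S x) x)"
    "\<And>C x. bounded_linear C \<Longrightarrow> C \<circ> A = A \<circ> C \<Longrightarrow> C (S x) = S (C x)"
proof -
  interpret A: bounded_linear A using A by (rule bounded_clinearD)
  obtain t b where t: "t > 0" and b: "0 \<le> b" "b < 1"
    and contr: "\<And>x. norm (x - t *\<^sub>R A x) \<le> b * norm x"
    using coercive_contraction[OF A.bounded_linear_axioms c coercive] by blast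
  define B where "B = Blinfun (\<lambda>x. x - t *\<^sub>R A x)"
  have "bounded_linear (\<lambda>x. x - t *\<^sub>R A x)"
    by (intro bounded_linear_intros A.bounded_linear_axioms)
  then have B: "B x = x - t *\<^sub>R A x" for x
    by (simp add: B_def bounded_linear_Blinfun_apply)
  have normB: "norm B \<le> b"
    by (rule norm_blinfun_bound) (use b contr in \<open>auto simp: B\<close>)
  \<comment> \<open>The smaller root of r^2 - 2 r + b = 0. Thus \<open>(b + r * r) / 2 = r\<close>,
    so the ball of radius \<open>r\<close> is mapped into itself, and \<open>r < 1\<close> serves as
    the contraction constant.\<close>
  define r where "r = 1 - sqrt (1 - b)"
  have r: "0 \<le> r" "r < 1" using b by (auto simp: r_def)
  have rb: "(b + r * r) / 2 = r"
    using b by (simp add: r_def power2_diff field_simps flip: power2_eq_square)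
  define M where "M = {Y. norm Y \<le> r
    \<and> (\<forall>x y. cinner (blinfun_apply Y x) y = cinner x (blinfun_apply Y y))
    \<and> (\<forall>C. C o\<^sub>L B = B o\<^sub>L C \<longrightarrow> C o\<^sub>L Y = Y o\<^sub>L C)}"
  let ?f = "\<lambda>Y. (1/2) *\<^sub>R (B + (Y o\<^sub>L Y))"
  have "\<exists>!Y. Y \<in> M \<and> ?f Y = Y"
  proof (rule Banach_fix[where c = r])
    \<comment> \<open>Each condition defining \<open>M\<close> is an equation or inequality between
      continuous functions of \<open>Y\<close>, or an implication with a premise independent of
      \<open>Y\<close>.\<close>
    have "closed M"
      unfolding M_def
      by (intro closed_Collect_conj closed_Collect_all closed_Collect_imp open_Collect_const
          closed_Collect_le closed_Collect_eq continuous_intros)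
    then show "complete M"
      by (simp add: complete_eq_closed)
    have "0 \<in> M" using r by (simp add: M_def)
    then show "M \<noteq> {}" by blast
    show "?f ` M \<subseteq> M"
    proof (intro image_subsetI)
      fix Y assume Y: "Y \<in> M"
      then have nY: "norm Y \<le> r"
        and sY: "\<And>x y. cinner (blinfun_apply Y x) y = cinner x (blinfun_apply Y y)"
        and cY: "\<And>C. C o\<^sub>L B = B o\<^sub>L C \<Longrightarrow> C o\<^sub>L Y = Y o\<^sub>L C"
        by (auto simp: M_def)
      have "norm (B + (Y o\<^sub>L Y)) \<le> b + r * r"
        using norm_triangle_ineq[of B "Y o\<^sub>L Y"] norm_blinfun_compose[of Y Y] normB
          mult_mono[OF nY nY r(1) norm_ge_zero] by linarith
      then have "norm (?f Y) \<le> r" using rb by simp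
      moreover have "cinner (?f Y x) y = cinner x (?f Y y)" for x y
        by (simp add: blinfun.bilinear_simps cinner_scaleR_left cinner_scaleR_right B sY sym
            cinner_add_left cinner_add_right cinner_diff_left cinner_diff_right)
      moreover have "C o\<^sub>L ?f Y = ?f Y o\<^sub>L C" if C: "C o\<^sub>L B = B o\<^sub>L C" for C
      proof (rule blinfun_eqI)
        fix x
        have "C (B x) = B (C x)" "C (Y z) = Y (C z)" for z
          using arg_cong[OF C, of "\<lambda>X. blinfun_apply X x"]
            arg_cong[OF cY[OF C], of "\<lambda>X. blinfun_apply X z"] by simp_all
        then show "(C o\<^sub>L ?f Y) x = (?f Y o\<^sub>L C) x"
          by (simp add: blinfun.bilinear_simps)
      qed
      ultimately show "?f Y \<in> M" by (simp add: M_def)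
    qed
    show "dist (?f Y) (?f Z) \<le> r * dist Y Z" if "Y \<in> M" "Z \<in> M" for Y Z
    proof -
      have nYZ: "norm Y \<le> r" "norm Z \<le> r" using that by (auto simp: M_def)
      \<comment> \<open>The difference of squares is split as Y (Y - Z) + (Y - Z) Z, which is valid
        without commutativity; each summand costs a factor \<open>r\<close>.\<close>
      have "?f Y - ?f Z = (1/2) *\<^sub>R ((Y o\<^sub>L (Y - Z)) + ((Y - Z) o\<^sub>L Z))"
        by (rule blinfun_eqI) (simp add: blinfun.bilinear_simps algebra_simps)
      then have "norm (?f Y - ?f Z) = norm ((Y o\<^sub>L (Y - Z)) + ((Y - Z) o\<^sub>L Z)) / 2"
        by simp
      also have "\<dots> \<le> (r * norm (Y - Z) + norm (Y - Z) * r) / 2"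
        using nYZ r
        by (intro divide_right_mono norm_triangle_le add_mono
            order_trans[OF norm_blinfun_compose] mult_mono) auto
      finally show ?thesis by (simp add: dist_norm mult.commute)
    qed
  qed (use r in auto)
  then obtain Y where "Y \<in> M \<and> ?f Y = Y"
    by (rule ex1E)
  note Y = conjunct1[OF this] conjunct2[OF this]
  from Y(1) have nY: "norm Y \<le> r"
    and sY: "\<And>x y. cinner (blinfun_apply Y x) y = cinner x (blinfun_apply Y y)"
    by (auto simp: M_def)
  have cY: "C (Y x) = Y (C x)" if C: "bounded_linear C" "\<And>x. C (B x) = B (C x)" for C x
  proof -
    have "Blinfun C o\<^sub>L B = B o\<^sub>L Blinfun C"
      by (rule blinfun_eqI) (simp add: C bounded_linear_Blinfun_apply)
    then have "Blinfun C o\<^sub>L Y = Y o\<^sub>L Blinfun C"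
      using Y(1) by (auto simp: M_def)
    from arg_cong[OF this, of "\<lambda>X. blinfun_apply X x"] show ?thesis
      by (simp add: C bounded_linear_Blinfun_apply)
  qed
  have YY: "Y (Y x) = 2 *\<^sub>R Y x - B x" for x
    using arg_cong[OF Y(2), of "\<lambda>X. 2 *\<^sub>R blinfun_apply X x"]
    by (simp add: blinfun.bilinear_simps algebra_simps)
  \<comment> \<open>The fixed point equation gives (I - Y)^2 = I - B = t A, so dividing I - Y by
    \<open>sqrt t\<close> produces a square root of \<open>A\<close>.\<close>
  define q where "q = 1 / sqrt t"
  have q: "q > 0" "q * q = 1 / t" using t by (auto simp: q_def)
  define S where "S = (\<lambda>x. q *\<^sub>R (x - Y x))"
  show thesis
  proof (rule that)
    have S_lin: "bounded_linear S"
      unfolding S_def by (intro bounded_linear_intros)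
    interpret S: bounded_linear S by fact
    show "S \<circ> S = A"
    proof
      fix x
      have "S (S x) = (q * q) *\<^sub>R (x - Y x - Y (x - Y x))"
        by (simp add: S_def blinfun.bilinear_simps algebra_simps)
      also have "\<dots> = (1 / t) *\<^sub>R (t *\<^sub>R A x)"
        unfolding q by (simp add: blinfun.bilinear_simps YY B scaleR_2)
      finally show "(S \<circ> S) x = A x" using t by simp
    qed
    show symS: "cinner (S x) y = cinner x (S y)" for x y
      by (simp add: S_def cinner_scaleR_left cinner_scaleR_right sY
            cinner_diff_left cinner_diff_right)
    show s: "q * (1 - r) > 0" using q r by simp
    show coS: "(q * (1 - r)) * (norm x)\<^sup>2 \<le> Re (cinner (S x) x)" for x
    proof -
      have "Re (cinner (Y x) x) \<le> norm (Y x) * norm x"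
        using abs_Re_cinner_le[of "Y x" x] by linarith
      also have "\<dots> \<le> (r * norm x) * norm x"
        using nY by (intro mult_right_mono order_trans[OF norm_blinfun]) auto
      finally have "(1 - r) * (norm x)\<^sup>2 \<le> (norm x)\<^sup>2 - Re (cinner (Y x) x)"
        by (simp add: power2_eq_square algebra_simps)
      with q have "q * ((1 - r) * (norm x)\<^sup>2) \<le> q * ((norm x)\<^sup>2 - Re (cinner (Y x) x))"
        by (intro mult_left_mono) auto
      then show ?thesis
        by (simp add: S_def cinner_scaleR_left cinner_diff_left cinner_self mult.assoc)
    qed
    show comm: "C (S x) = S (C x)" if C: "bounded_linear C" "C \<circ> A = A \<circ> C" for C x
    proof -
      interpret C: bounded_linear C by fact
      have "C (A x) = A (C x)" for x using C(2) by (metis comp_apply)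
      then have "C (Y x) = Y (C x)"
        by (intro cY C) (simp add: B C.diff C.scaleR)
      then show ?thesis by (simp add: S_def C.diff C.scaleR)
    qed
    \<comment> \<open>The operators \<open>B\<close> and \<open>Y\<close> were built as real bounded
      linear maps. Complex linearity is recovered from the commutation property, since
      multiplication by \<open>k\<close> commutes with \<open>A\<close>.\<close>
    have "S (k *\<^sub>C x) = k *\<^sub>C S x" for k x
    proof (rule comm[symmetric])
      show "bounded_linear (\<lambda>x. k *\<^sub>C x)"
        by (rule bounded_linear_intro[where K = "cmod k"])
          (auto simp: scaleC_add_right scaleC_scaleC norm_scaleC mult.commute
            simp flip: scaleC_of_real)
    qed (simp add: fun_eq_iff bounded_clinearD[OF A])
    moreover have "cinner (S x) x \<in> \<real>\<^sub>\<ge>\<^sub>0" for x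
    proof -
      have "cnj (cinner (S x) x) = cinner (S x) x"
        by (metis cinner_commute symS)
      then have "Im (cinner (S x) x) = 0" by (simp add: complex_eq_iff)
      moreover have "0 \<le> Re (cinner (S x) x)"
        by (rule order_trans[OF mult_nonneg_nonneg coS[of x]]) (use s in simp_all)
      ultimately show ?thesis by (simp add: complex_nonneg_Reals_iff)
    qed
    ultimately show "positive_op S"
      by (simp add: positive_op_def bounded_clinear_def S_lin)
  qed
qed

text \<open>For commuting roots, (S + R)(S - R) = S^2 - R^2 = 0. Pairing
  \<open>S y + R y = 0\<close> with \<open>y = S x - R x\<close> makes two nonnegative terms sum to
  zero, and coercivity of \<open>S\<close> forces \<open>y = 0\<close>.\<close>

lemma positive_sqrt_unique:
  assumes S: "positive_op S" and s: "s > 0" "\<And>x. s * (norm x)\<^sup>2 \<le> Re (cinner (S x) x)"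
    and R: "positive_op R" and eq: "R \<circ> R = S \<circ> S"
    and comm: "\<And>x. R (S x) = S (R x)"
  shows "R = S"
proof
  fix x
  interpret S: bounded_linear S using S by (auto simp: positive_op_def bounded_clinear_def)
  interpret R: bounded_linear R using R by (auto simp: positive_op_def bounded_clinear_def)
  define y where "y = S x - R x"
  have "S (S x) = R (R x)" using eq by (metis comp_apply)
  then have "S y + R y = 0"
    by (simp add: y_def S.diff R.diff comm)
  then have "Re (cinner (S y) y) + Re (cinner (R y) y) = 0"
    by (metis cinner_add_left cinner_zero_left plus_complex.sel(1) zero_complex.sel(1))
  moreover have "0 \<le> Re (cinner (R y) y)"
    using R by (auto simp: positive_op_def complex_nonneg_Reals_iff)
  ultimately have "s * (norm y)\<^sup>2 \<le> 0" using s(2)[of y] by linarith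
  with s(1) show "R x = S x"
    by (simp add: y_def mult_le_0_iff)
qed

text \<open>The inverse root is symmetric and its square is \<open>inv A\<close>, so moving one
  factor across the inner product gives the formula.\<close>

lemma norm_inv_sqrt_op:
  assumes A: "bounded_clinear A" and c: "c > 0"
    and coercive: "\<And>x. c * (norm x)\<^sup>2 \<le> Re (cinner (A x) x)"
    and sym: "\<And>x y. cinner (A x) y = cinner x (A y)"
  shows "(norm (inv_sqrt_op A v))\<^sup>2 = Re (cinner (inv A v) v)"
proof -
  obtain S s where S: "positive_op S" "S \<circ> S = A" "s > 0"
    "\<And>x y. cinner (S x) y = cinner x (S y)"
    "\<And>x. s * (norm x)\<^sup>2 \<le> Re (cinner (S x) x)"
    "\<And>C x. bounded_linear C \<Longrightarrow> C \<circ> A = A \<circ> C \<Longrightarrow> C (S x) = S (C x)"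
    using coercive_sqrt_exists[OF assms] by blast
  have sqrt: "sqrt_op A = S"
    unfolding sqrt_op_def
  proof (rule the_equality)
    \<comment> \<open>A competing root \<open>R\<close> commutes with
      \<open>A = R \<circ> R\<close>, hence with \<open>S\<close> by the commutation property; this
      resolves the definite description in \<open>sqrt_op\<close>.\<close>
    fix R assume R: "positive_op R \<and> R \<circ> R = A"
    then have "R (S x) = S (R x)" for x
      by (intro S(6)) (auto simp: positive_op_def bounded_clinear_def)
    then show "R = S"
      using positive_sqrt_unique[OF S(1,3,5)] R S(2) by simp
  qed (use S in simp)
  have "bij S"
    using S by (intro coercive_bij[of S s]) (auto simp: positive_op_def bounded_clinear_def)
  then have S_inv: "S (inv S x) = x" for x
    by (simp add: bij_is_surj surj_f_inv_f)
  have "inj A"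
    using coercive_bij[OF bounded_clinearD(1)[OF A] c coercive] by (simp add: bij_is_inj)
  then have "inv A v = inv S (inv S v)"
    by (rule inv_f_eq) (simp add: S(2)[symmetric] S_inv)
  then have "cinner (inv A v) v = cinner (inv S v) (inv S v)"
    by (metis S(4) S_inv)
  then show ?thesis
    by (simp add: inv_sqrt_op_def sqrt cinner_self)
qed


subsection \<open>Orthogonal projections\<close>

lemma csubspace_orth_compl: "csubspace (orth_compl M)"
  by (auto simp: csubspace_def orth_compl_def cinner_add_left cinner_scaleC_left)

lemma closed_orth_compl: "closed (orth_compl M)"
  unfolding orth_compl_def Ball_def
  by (intro closed_Collect_all closed_Collect_imp open_Collect_const closed_Collect_eq
      continuous_intros)

lemma is_orth_projD:
  assumes "is_orth_proj P M"
  shows "csubspace M" "closed M" "P h \<in> M" "h - P h \<in> orth_compl M"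
    "m \<in> M \<Longrightarrow> cinner (h - P h) m = 0"
  using assms by (auto simp: is_orth_proj_def orth_compl_def)

lemma is_orth_proj_compl:
  assumes P: "is_orth_proj P M"
  shows "is_orth_proj (\<lambda>h. h - P h) (orth_compl M)"
proof -
  have "cinner (P h) m = 0" if "m \<in> orth_compl M" for h m
  proof -
    have "cinner m (P h) = 0"
      using that is_orth_projD(3)[OF P] by (auto simp: orth_compl_def)
    then show ?thesis by (metis cinner_commute complex_cnj_zero)
  qed
  then have "P h \<in> orth_compl (orth_compl M)" for h
    by (simp add: orth_compl_def)
  then show ?thesis
    using is_orth_projD(4)[OF P] csubspace_orth_compl[of M] closed_orth_compl[of M]
    by (simp add: is_orth_proj_def)
qed

text \<open>Residuals are orthogonal to all values of \<open>P\<close>. Together the two equations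
  give the symmetry \<open>cinner (P x) y = cinner x (P y)\<close>.\<close>

lemma is_orth_proj_cinner:
  assumes P: "is_orth_proj P M"
  shows "cinner (P x) y = cinner (P x) (P y)" "cinner x (P y) = cinner (P x) (P y)"
proof -
  have "cinner (z - P z) (P w) = 0" for z w
    by (intro is_orth_projD[OF P])
  then show *: "cinner x (P y) = cinner (P x) (P y)" for x y
    by (simp add: cinner_diff_left)
  show "cinner (P x) y = cinner (P x) (P y)"
    using arg_cong[OF *[of y x], of cnj] by (simp only: cinner_commute[symmetric])
qed

lemma is_orth_proj_eq_0:
  assumes P: "is_orth_proj P M" and k: "k \<in> orth_compl M"
  shows "P k = 0"
proof -
  have "cinner (P k) (P k) = cinner k (P k)"
    by (rule is_orth_proj_cinner(2)[OF P, symmetric])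
  also have "\<dots> = 0"
    using k is_orth_projD(3)[OF P] by (simp add: orth_compl_def)
  finally show ?thesis by simp
qed

lemma is_orth_proj_ident:
  assumes P: "is_orth_proj P M" and h: "h \<in> M"
  shows "P h = h"
proof -
  have "h - P h \<in> M"
    by (rule csubspace_diff[OF is_orth_projD(1)[OF P] h is_orth_projD(3)[OF P]])
  then have "cinner (h - P h) (h - P h) = 0"
    by (rule is_orth_projD[OF P])
  then show ?thesis by simp
qed

lemma range_orth_proj:
  assumes P: "is_orth_proj P M"
  shows "range P = M"
proof
  show "M \<subseteq> range P"
    using is_orth_proj_ident[OF P] by (metis rangeI subsetI)
qed (use is_orth_projD(3)[OF P] in blast)

text \<open>By Pythagoras the squared norms of \<open>E n h\<close> decrease, hence converge, and
  their differences are the squared distances between the terms; so \<open>E n h\<close> is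
  Cauchy.\<close>

lemma decreasing_orth_proj_convergent:
  assumes E: "\<And>n. is_orth_proj (E n) (M n)" and M: "decseq M"
  obtains P where "is_orth_proj P (\<Inter>n. M n)" "\<And>h. (\<lambda>n. E n h) \<longlonglongrightarrow> P h"
proof -
  note D = is_orth_projD[OF E]
  have pyth: "(norm (E n h))\<^sup>2 = (norm (E m h))\<^sup>2 + (norm (E n h - E m h))\<^sup>2" if "n \<le> m" for n m h
  proof -
    have "E m h \<in> M n" using D(3)[of m h] M that by (auto simp: decseq_def)
    then have "cinner (E n h) (E m h) = cinner h (E m h)"
      using D(5)[of "E m h" n h] by (simp add: cinner_diff_left)
    also have "\<dots> = cinner (E m h) (E m h)"
      by (rule is_orth_proj_cinner(2)[OF E])
    finally show ?thesis
      by (simp add: norm_diff_square cinner_self)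
  qed
  have "convergent (\<lambda>n. E n h)" for h
  proof -
    define a where "a n = (norm (E n h))\<^sup>2" for n
    have dec: "a m \<le> a n" if "n \<le> m" for n m
      using pyth[OF that, of h] by (simp add: a_def)
    have "Bseq a"
      using dec[of 0] by (intro BseqI'[of _ "a 0"]) (auto simp: a_def)
    then have "convergent a"
      using dec by (intro Bseq_monoseq_convergent decseq_imp_monoseq) (auto simp: decseq_def)
    then have "Cauchy a" by (rule convergent_Cauchy)
    have "Cauchy (\<lambda>n. E n h)"
    proof (rule metric_CauchyI)
      fix e :: real assume e: "e > 0"
      then obtain N where N: "\<And>m n. m \<ge> N \<Longrightarrow> n \<ge> N \<Longrightarrow> dist (a m) (a n) < e\<^sup>2"
        using \<open>Cauchy a\<close> unfolding Cauchy_def by (meson zero_less_power)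
      have "dist (E m h) (E n h) < e" if "N \<le> n" "n \<le> m" for m n
      proof -
        have "(norm (E n h - E m h))\<^sup>2 = a n - a m"
          using pyth[OF that(2), of h] by (simp add: a_def)
        also have "\<dots> < e\<^sup>2"
          using N[of n m] that by (simp add: dist_real_def)
        finally show ?thesis
          using e by (simp add: dist_norm norm_minus_commute power_less_imp_less_base)
      qed
      then have "dist (E m h) (E n h) < e" if "N \<le> m" "N \<le> n" for m n
        using that by (metis dist_commute nle_le)
      then show "\<exists>N. \<forall>m\<ge>N. \<forall>n\<ge>N. dist (E m h) (E n h) < e"
        by blast
    qed
    then show ?thesis by (rule Cauchy_convergent)
  qed
  then obtain P where P: "\<And>h. (\<lambda>n. E n h) \<longlonglongrightarrow> P h"
    unfolding convergent_def by metis
  have "csubspace (\<Inter>n. M n)"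
    using D(1) by (fastforce simp: csubspace_def)
  moreover have "closed (\<Inter>n. M n)"
    using D(2) by blast
  moreover have "P h \<in> M n" for h n
  \<comment> \<open>From index \<open>n\<close> on, the sequence stays in the closed set
    \<open>M n\<close>.\<close>
  proof (rule Lim_in_closed_set[OF D(2) _ _ P])
    show "\<forall>\<^sub>F k in sequentially. E k h \<in> M n"
      using eventually_ge_at_top[of n] by eventually_elim (rule subsetD[OF decseqD[OF M] D(3)])
  qed simp
  moreover have "cinner (h - P h) m = 0" if "m \<in> (\<Inter>n. M n)" for h m
  proof (rule LIMSEQ_unique)
    show "(\<lambda>n. cinner (h - E n h) m) \<longlonglongrightarrow> cinner (h - P h) m"
      by (intro tendsto_intros P)
    show "(\<lambda>n. cinner (h - E n h) m) \<longlonglongrightarrow> 0"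
      using that D(5) by simp
  qed
  ultimately have "is_orth_proj P (\<Inter>n. M n)"
    by (simp add: is_orth_proj_def orth_compl_def)
  then show thesis using P that by blast
qed


subsection \<open>Left invertible operators\<close>

context
  fixes T :: "'a::complex_hilbert_space \<Rightarrow> 'a"
  assumes T: "bounded_clinear T" and inv: "left_invertible T"
begin

lemma left_invertible_bounded_below:
  obtains c where "c > 0" "\<And>x. c * norm x \<le> norm (T x)"
proof -
  obtain S where S: "bounded_clinear S" "S \<circ> T = id"
    using inv by (auto simp: left_invertible_def)
  obtain K where K: "K > 0" "\<And>x. norm (S x) \<le> norm x * K"
    using bounded_linear.pos_bounded[OF bounded_clinearD(1)[OF S(1)]] by blast
  have "1 / K * norm x \<le> norm (T x)" for x
    using K(2)[of "T x"] K(1) pointfree_idE[OF S(2)] by (simp add: field_simps)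
  then show thesis using K(1) that[of "1 / K"] by simp
qed

lemma gram_symmetric: "cinner ((cadjoint T \<circ> T) x) y = cinner x ((cadjoint T \<circ> T) y)"
  by (simp add: cinner_cadjoint[OF T, symmetric] cinner_cadjoint_left[OF T])

lemma gram_coercive:
  obtains c where "c > 0" "\<And>x. c * (norm x)\<^sup>2 \<le> Re (cinner ((cadjoint T \<circ> T) x) x)"
proof -
  obtain c where c: "c > 0" "\<And>x. c * norm x \<le> norm (T x)"
    using left_invertible_bounded_below by blast
  have "c\<^sup>2 * (norm x)\<^sup>2 \<le> Re (cinner ((cadjoint T \<circ> T) x) x)" for x
    using power_mono[OF c(2)[of x], of 2] c(1)
    by (simp add: cinner_cadjoint_left[OF T] cinner_self power_mult_distrib)
  then show thesis using c(1) that[of "c\<^sup>2"] by simp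
qed

lemma bounded_clinear_gram: "bounded_clinear (cadjoint T \<circ> T)"
  by (intro bounded_clinear_comp bounded_clinear_cadjoint T)

text \<open>Guarantees that \<open>inv\<close> in \<open>can_left_inv\<close> is a genuine two-sided
  inverse.\<close>

lemma bij_gram: "bij (cadjoint T \<circ> T)"
proof -
  obtain c where "c > 0" "\<And>x. c * (norm x)\<^sup>2 \<le> Re (cinner ((cadjoint T \<circ> T) x) x)"
    using gram_coercive by blast
  then show ?thesis
    by (rule coercive_bij[OF bounded_clinearD(1)[OF bounded_clinear_gram]])
qed

lemma can_left_inv_cancel: "can_left_inv T (T x) = x"
  using inv_f_f[OF bij_is_inj[OF bij_gram], of x] by (simp add: can_left_inv_def)

lemma cadjoint_can_left_inv: "cadjoint T (T (can_left_inv T h)) = cadjoint T h"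
  using surj_f_inv_f[OF bij_is_surj[OF bij_gram], of "cadjoint T h"] by (simp add: can_left_inv_def)

text \<open>The adjoint annihilates the residual, as T* T T^- h = T* h, so the residual is
  orthogonal to the range. The range is closed because \<open>T\<close> is bounded below.\<close>

lemma is_orth_proj_range: "is_orth_proj (\<lambda>h. T (can_left_inv T h)) (range T)"
proof -
  interpret T: bounded_linear T using T by (rule bounded_clinearD)
  have "csubspace (range T)"
    unfolding csubspace_def
  proof (intro conjI ballI allI)
    show "0 \<in> range T"
      by (rule range_eqI[of _ T 0]) (rule T.zero[symmetric])
  next
    fix x y assume "x \<in> range T" "y \<in> range T"
    then obtain u v where "x = T u" "y = T v" by blast
    then show "x + y \<in> range T"
      by (intro range_eqI[of _ T "u + v"]) (simp only: T.add)
  next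
    fix c x assume "x \<in> range T"
    then obtain u where "x = T u" by blast
    then show "c *\<^sub>C x \<in> range T"
      by (intro range_eqI[of _ T "c *\<^sub>C u"]) (simp only: bounded_clinearD(2)[OF T])
  qed
  moreover have "closed (range T)"
  proof -
    obtain c where "c > 0" "\<And>x. c * norm x \<le> norm (T x)"
      using left_invertible_bounded_below by blast
    then have "complete (range T)"
      by (intro complete_isometric_image[of c]) (auto simp: T.bounded_linear_axioms complete_UNIV)
    then show ?thesis by (simp add: complete_eq_closed)
  qed
  moreover have "cinner (h - T (can_left_inv T h)) (T z) = 0" for h z
    unfolding cinner_cadjoint_left[OF T, symmetric]
    by (simp add: linear_diff[OF bounded_linear.linear[OF bounded_clinearD(1)[OF bounded_clinear_cadjoint[OF T]]]]
        cadjoint_can_left_inv)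
  ultimately show ?thesis
    by (auto simp: is_orth_proj_def orth_compl_def)
qed

text \<open>The squared left side is the inner product of T^- h and T* h, that is, of T T^- h and h.
  As T T^- is an orthogonal projection, this is the squared norm of T T^- h.\<close>

lemma norm_inv_sqrt_gram:
  "norm (inv_sqrt_op (cadjoint T \<circ> T) (cadjoint T h)) = norm (T (can_left_inv T h))"
proof -
  obtain c where c: "c > 0" "\<And>x. c * (norm x)\<^sup>2 \<le> Re (cinner ((cadjoint T \<circ> T) x) x)"
    using gram_coercive by blast
  have "(norm (inv_sqrt_op (cadjoint T \<circ> T) (cadjoint T h)))\<^sup>2
      = Re (cinner (can_left_inv T h) (cadjoint T h))"
    unfolding norm_inv_sqrt_op[OF bounded_clinear_gram c gram_symmetric] can_left_inv_def comp_apply ..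
  also have "\<dots> = Re (cinner (T (can_left_inv T h)) h)"
    by (simp only: cinner_cadjoint[OF T])
  also have "\<dots> = Re (cinner (T (can_left_inv T h)) (T (can_left_inv T h)))"
    by (subst is_orth_proj_cinner(1)[OF is_orth_proj_range, of h h]) (rule refl)
  also have "\<dots> = (norm (T (can_left_inv T h)))\<^sup>2"
    by (simp only: cinner_self Re_complex_of_real)
  finally show ?thesis
    by (rule power2_eq_imp_eq) simp_all
qed

end

section \<open>Powers of operators in the class D\<close>

lemma left_invertible_funpow:
  assumes T: "left_invertible T"
  shows "left_invertible (T ^^ n)"
proof -
  obtain S where S: "bounded_clinear S" "S \<circ> T = id"
    using T by (auto simp: left_invertible_def)
  have "(S ^^ n) \<circ> (T ^^ n) = id"
    using funpow_inverse_cancel[OF S(2), of n] by (simp add: fun_eq_iff)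
  then show ?thesis
    using bounded_clinear_funpow[OF S(1)] unfolding left_invertible_def by blast
qed

lemma can_left_inv_id: "can_left_inv id = id"
proof -
  have "cadjoint id = (id :: 'a \<Rightarrow> 'a)" by (rule cadjoint_eqI) simp
  then show ?thesis by (simp add: can_left_inv_def inv_id)
qed

text \<open>The definition of the class starts at exponent 2; exponents 0 and 1 are automatic.
  Having 0 available lets the projections start at the identity.\<close>

lemma class_D_can_left_inv_funpow:
  assumes "T \<in> class_D"
  shows "can_left_inv (T ^^ n) = can_left_inv T ^^ n"
proof -
  consider "n = 0" | "n = 1" | "n \<ge> 2" by linarith
  then show ?thesis
  proof cases
    case 1
    then show ?thesis using can_left_inv_id by (simp add: id_def)
  next
    case 2
    then show ?thesis by simp
  next
    case 3
    then show ?thesis using assms by (simp add: class_D_def)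
  qed
qed

theorem theorem1:
  fixes T P0 :: "'a::complex_hilbert_space \<Rightarrow> 'a"
  assumes T: "T \<in> class_D"
  assumes P0: "P0 = (\<lambda>h. h - T (can_left_inv T h))"
  shows "is_orth_proj P0 (orth_compl (range T)) \<and>
    (\<exists>P Q. is_orth_proj P (\<Inter>n\<in>{1..}. range (T ^^ n)) \<and>
      Q = (\<lambda>h. h - P h) \<and>
      (\<forall>h. (\<lambda>n. (T ^^ n) ((can_left_inv T ^^ n) h)) \<longlonglongrightarrow> P h) \<and>
      (\<forall>h. (\<lambda>j. (T ^^ j) (P0 ((can_left_inv T ^^ j) h))) sums Q h) \<and>
      range Q = {h. (\<lambda>n. norm (inv_sqrt_op ((cadjoint T ^^ n) \<circ> (T ^^ n))
                                 ((cadjoint T ^^ n) h))) \<longlonglongrightarrow> 0} \<and>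
      reduces (range P) T \<and> reduces (range Q) T \<and>
      T ` range P = range P \<and>
      (\<forall>h. summable (\<lambda>j. (T ^^ j) (P0 ((can_left_inv T ^^ j) h))) \<and>
           h = P h + (\<Sum>j. (T ^^ j) (P0 ((can_left_inv T ^^ j) h)))))"
proof -
  let ?L = "can_left_inv T"
  have bT: "bounded_clinear T" and iT: "left_invertible T"
    using T by (auto simp: class_D_def)
  note bTn = bounded_clinear_funpow[OF bT]
  note iTn = left_invertible_funpow[OF iT]
  interpret T: bounded_linear T using bT by (rule bounded_clinearD)
  have proj0: "is_orth_proj P0 (orth_compl (range T))"
    unfolding P0 by (intro is_orth_proj_compl is_orth_proj_range bT iT)
  define E where "E n h = (T ^^ n) ((?L ^^ n) h)" for n h
  define M where "M n = range (T ^^ n)" for n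
  \<comment> \<open>Membership in the class enters here: it identifies T^n (T^n)^-, a projection for
    any left invertible \<open>T\<close>, with T^n (T^-)^n.\<close>
  have E: "is_orth_proj (E n) (M n)" for n
    using is_orth_proj_range[OF bTn iTn, of n]
    unfolding class_D_can_left_inv_funpow[OF T] M_def E_def by simp
  have M: "decseq M"
    unfolding decseq_Suc_iff M_def by (auto simp: funpow_swap1)
  obtain P where P: "is_orth_proj P (\<Inter>n. M n)" and lim: "\<And>h. (\<lambda>n. E n h) \<longlonglongrightarrow> P h"
    using decreasing_orth_proj_convergent[OF E M] by blast
  define Q where "Q h = h - P h" for h
  have Q: "is_orth_proj Q (orth_compl (\<Inter>n. M n))"
    unfolding Q_def using is_orth_proj_compl[OF P] .
  \<comment> \<open>The sequence starts at 0 but the claim intersects from 1; the extra set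
    \<open>M 0\<close> is the whole space.\<close>
  have "(\<Inter>n. M n) = (\<Inter>n\<in>{1..}. M n)"
  proof -
    have "M 0 = UNIV" by (simp add: M_def)
    moreover have "UNIV = insert 0 {1::nat..}" by auto
    then have "(\<Inter>n. M n) = M 0 \<inter> (\<Inter>n\<in>{1..}. M n)"
      by (metis INT_insert)
    ultimately show ?thesis by simp
  qed
  with P have projP: "is_orth_proj P (\<Inter>n\<in>{1..}. range (T ^^ n))"
    by (simp add: M_def)

  have TPL: "T (P (?L h)) = P h" for h
  proof (rule LIMSEQ_unique)
    show "(\<lambda>n. T (E n (?L h))) \<longlonglongrightarrow> T (P (?L h))"
      by (intro T.tendsto lim)
    have "T (E n (?L h)) = E (Suc n) h" for n
      by (simp add: E_def funpow_swap1)
    then show "(\<lambda>n. T (E n (?L h))) \<longlonglongrightarrow> P h"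
      using LIMSEQ_Suc[OF lim] by simp
  qed
  \<comment> \<open>Apply \<open>TPL\<close> to \<open>T h\<close> and cancel with T^- T =
    I.\<close>
  have TP: "T (P h) = P (T h)" for h
    using TPL[of "T h"] by (simp add: can_left_inv_cancel[OF bT iT])
  have T'P: "cadjoint T (P h) = P (cadjoint T h)" for h
  proof -
    \<comment> \<open>Take adjoints in \<open>T P = P T\<close>, using that \<open>P\<close> is
      symmetric.\<close>
    have "cinner z (cadjoint T (P h)) = cinner z (P (cadjoint T h))" for z
      by (metis TP cinner_cadjoint[OF bT] is_orth_proj_cinner[OF P])
    then show ?thesis using cinner_eq_right_iff by blast
  qed
  interpret T': bounded_linear "cadjoint T"
    by (intro bounded_clinearD bounded_clinear_cadjoint bT)

  have redP: "reduces (range P) T"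
    using is_orth_projD(1,2)[OF P] unfolding reduces_def range_orth_proj[OF P, symmetric]
    by (auto simp: TP T'P)
  have redQ: "reduces (range Q) T"
  proof -
    have "T (Q h) = Q (T h)" "cadjoint T (Q h) = Q (cadjoint T h)" for h
      by (simp_all add: Q_def T.diff T'.diff TP T'P)
    then show ?thesis
      using is_orth_projD(1,2)[OF Q] unfolding reduces_def range_orth_proj[OF Q, symmetric]
      by auto
  qed
  \<comment> \<open>By \<open>TPL\<close>, the vector \<open>P (?L h)\<close> is a preimage of
    \<open>P h\<close> inside the range of \<open>P\<close>.\<close>
  have surj: "T ` range P = range P"
    using TP TPL by (auto simp: image_iff) metis

  have sums: "(\<lambda>j. (T ^^ j) (P0 ((?L ^^ j) h))) sums Q h" for h
  proof -
    \<comment> \<open>Conjugating I - T T^- by the powers gives a difference of consecutive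
      projections. The sum telescopes from \<open>E 0\<close>, which is the identity.\<close>
    have step: "(T ^^ j) (P0 ((?L ^^ j) h)) = E j h - E (Suc j) h" for j
    proof -
      interpret Tj: bounded_linear "T ^^ j" using bTn by (rule bounded_clinearD)
      show ?thesis by (simp add: E_def P0 Tj.diff funpow_swap1)
    qed
    have "(\<lambda>j. E j h - E (Suc j) h) sums (E 0 h - P h)"
      by (rule telescope_sums'[OF lim])
    then show ?thesis by (simp add: step Q_def E_def)
  qed

  have rangeQ: "range Q = {h. (\<lambda>n. norm (inv_sqrt_op ((cadjoint T ^^ n) \<circ> (T ^^ n))
                                 ((cadjoint T ^^ n) h))) \<longlonglongrightarrow> 0}"
  proof -
    have "norm (inv_sqrt_op ((cadjoint T ^^ n) \<circ> (T ^^ n)) ((cadjoint T ^^ n) h)) = norm (E n h)"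
      for n h
      using norm_inv_sqrt_gram[OF bTn iTn, of n h]
      unfolding cadjoint_funpow[OF bT] class_D_can_left_inv_funpow[OF T] E_def .
    \<comment> \<open>The norms always converge to \<open>norm (P h)\<close>, so their limit is 0
      exactly when \<open>P h = 0\<close>.\<close>
    moreover have "(\<lambda>n. norm (E n h)) \<longlonglongrightarrow> 0 \<longleftrightarrow> P h = 0" for h
      using LIMSEQ_unique[OF tendsto_norm[OF lim[of h]], of 0] tendsto_norm[OF lim[of h]]
      by (metis norm_eq_zero)
    moreover have "range Q = {h. P h = 0}"
    proof -
      have "P (Q h) = 0" for h
        using is_orth_proj_eq_0[OF P] is_orth_projD(3)[OF Q] by blast
      moreover have "h = Q h" if "P h = 0" for h
        using that by (simp add: Q_def)
      ultimately show ?thesis by (auto intro: range_eqI)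
    qed
    ultimately show ?thesis by simp
  qed

  have expansion: "summable (\<lambda>j. (T ^^ j) (P0 ((?L ^^ j) h)))"
    "h = P h + (\<Sum>j. (T ^^ j) (P0 ((?L ^^ j) h)))" for h
    using sums[of h] by (auto simp: sums_iff Q_def)
  have Q_eq: "Q = (\<lambda>h. h - P h)"
    by (simp add: Q_def fun_eq_iff)
  show ?thesis
    by (intro conjI exI[of _ P] exI[of _ Q] allI)
      (rule proj0 projP Q_eq lim[unfolded E_def] sums rangeQ redP redQ surj expansion)+
qed

end
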